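(* Let $G$ and $H$ be finitely generated free groups. \begin{enumerate} \item (Doubly-twisted version) If $\phi,\psi:G\to H$ are homomorphisms such that $\phi$ has remnant and $|\operatorname{Rem}_\phi a|>|\psi(a)|$ for every generator $a\in G$, then there is an algorithm to decide, for any $u,v\in H$, whether or not there is some $z\in G$ with \[ u=\phi(z)\,v\,\psi(z)^{-1}. \] \item (Singly-twisted version) If $\phi:G\to G$ is a homomorphism having remnant with $|\operatorname{Rem}_\phi a|>1$ for every generator $a\in G$, then there is an algorithm to decide, for any $u,v\in G$, whether or not there is some $z\in G$ with \[ v=\phi(z)\,u\,z^{-1}. \] \item ($\psi=1$ version) If $\phi:G\to H$ is a homomorphism with remnant, then there is an algorithm to decide, for any $w\in H$, whether or not $w\in\phi(G)$. \end{enumerate}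
   Context: Free groups come with fixed finite free generating sets, elements are given as words in the generators, homomorphisms by the images of the generators; $|w|$ denotes reduced word length. Let $a_1,\dots,a_n$ be the generators of $G$. Remnant. Let $t=(h_1,\dots,h_n)$ be a tuple of reduced words in a free group. We say $t$ has remnant when, for each $i$, there is a nontrivial subword of $h_i$ which does not cancel in any product of the form $h_j^{\alpha_j}h_ih_k^{\beta_k}$, where $j,k\in\{1,\dots,n\}$, with $\alpha_r,\beta_r\in\{-1,0,1\}$ for $r\ne i$ and $\alpha_i,\beta_i\in\{0,1\}$. The (maximal) such noncancelling subword is the remnant of $h_i$. Explicitly: delete from $h_i$ the longest initial segment that cancels in some product $h_j^{\alpha_j}h_i$ and the longest terminal segment that cancels in some product $h_ih_k^{\beta_k}$ (with $j,k\in\{1,\dots,n\}$, $\alpha_j\in\{-1,0,1\}$ if $j\ne i$ and $\alpha_j\in\{0,1\}$ if $j=i$, $\beta_k\in\{-1,0,1\}$ if $k\ne i$ and $\beta_k\in\{0,1\}$ if $k=i$); $t$ has remnant if for each $i$ these segments have total length less than $|h_i|$, and what is left is the remnant of $h_i$. A homomorphism $\phi$ from $G$ to a free group has remnant if $(\phi(a_1),\dots,\phi(a_n))$ has remnant, and $\operatorname{Rem}_\phi a_i$ denotes the remnant of $\phi(a_i)$. *)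

theory Defs
  imports "HOL-Algebra.Group" "HOL-Library.Sublist" "HOL-Library.Nat_Bijection"
begin

section \<open>Free groups of finite rank\<close>

text \<open>The letter \<open>(i, True)\<close> is the generator \<open>a\<^sub>i\<close>, and \<open>(i, False)\<close> is its inverse.\<close>

type_synonym letter = "nat \<times> bool"
type_synonym word = "letter list"

definition flip :: "letter \<Rightarrow> letter" where
  "flip x = (fst x, \<not> snd x)"

definition word_inv :: "word \<Rightarrow> word" where
  "word_inv w = rev (map flip w)"

definition reduced :: "word \<Rightarrow> bool" where
  "reduced w \<longleftrightarrow> successively (\<lambda>x y. y \<noteq> flip x) w"

definition cons_red :: "letter \<Rightarrow> word \<Rightarrow> word" where
  "cons_red x w = (case w of [] \<Rightarrow> [x] | y # ys \<Rightarrow> if y = flip x then ys else x # w)"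

definition reduce :: "word \<Rightarrow> word" where
  "reduce w = foldr cons_red w []"

definition words :: "nat \<Rightarrow> word set" where
  "words n = {w. \<forall>x\<in>set w. fst x < n}"

definition free_group :: "nat \<Rightarrow> word monoid" where
  "free_group n = \<lparr>carrier = {w \<in> words n. reduced w}, mult = (\<lambda>x y. reduce (x @ y)), one = []\<rparr>"

definition gen :: "nat \<Rightarrow> word" where
  "gen i = [(i, True)]"

lemma flip_flip [simp]: "flip (flip x) = x"
  by (simp add: flip_def)

lemma flip_eq_iff: "flip x = y \<longleftrightarrow> x = flip y"
  by (metis flip_flip)

lemma reduced_Nil [simp]: "reduced []"
  by (simp add: reduced_def)

lemma reduced_Cons: "reduced (x # w) \<longleftrightarrow> reduced w \<and> (w = [] \<or> hd w \<noteq> flip x)"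
  by (auto simp: reduced_def successively_Cons)

lemma reduced_cons_red: "reduced w \<Longrightarrow> reduced (cons_red x w)"
  by (cases w) (auto simp: cons_red_def reduced_Cons)

lemma cons_red_flip: "reduced w \<Longrightarrow> cons_red x (cons_red (flip x) w) = w"
  by (cases w) (auto simp: cons_red_def reduced_Cons split: list.splits)

lemma reduced_foldr: "reduced w \<Longrightarrow> reduced (foldr cons_red x w)"
  by (induction x) (auto simp: reduced_cons_red)

lemma reduced_reduce: "reduced (reduce w)"
  by (simp add: reduce_def reduced_foldr)

lemma reduce_reduced: "reduced w \<Longrightarrow> reduce w = w"
  by (induction w) (auto simp: reduce_def reduced_Cons cons_red_def split: list.splits)

lemma foldr_cons_red:
  "reduced w \<Longrightarrow> foldr cons_red (cons_red a r) w = cons_red a (foldr cons_red r w)"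
proof (cases r)
  case (Cons y ys)
  assume "reduced w"
  then have "cons_red a (cons_red (flip a) (foldr cons_red ys w)) = foldr cons_red ys w"
    by (intro cons_red_flip reduced_foldr)
  then show ?thesis
    by (auto simp: Cons cons_red_def)
qed (simp add: cons_red_def)

lemma foldr_reduce:
  "reduced w \<Longrightarrow> foldr cons_red (reduce x) w = foldr cons_red x w"
  by (induction x) (auto simp: reduce_def foldr_cons_red)

lemma reduce_append: "reduce (x @ y) = foldr cons_red x (reduce y)"
  by (simp add: reduce_def)

lemma reduce_append_left: "reduce (reduce x @ y) = reduce (x @ y)"
  by (simp add: reduce_append foldr_reduce reduced_reduce)

lemma reduce_append_right: "reduce (x @ reduce y) = reduce (x @ y)"
  by (simp add: reduce_append reduce_reduced reduced_reduce)

lemma words_Nil [simp]: "[] \<in> words n"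
  by (simp add: words_def)

lemma words_append: "x \<in> words n \<Longrightarrow> y \<in> words n \<Longrightarrow> x @ y \<in> words n"
  by (auto simp: words_def)

lemma words_cons_red: "fst x < n \<Longrightarrow> w \<in> words n \<Longrightarrow> cons_red x w \<in> words n"
  by (auto simp: cons_red_def words_def split: list.splits)

lemma words_reduce: "w \<in> words n \<Longrightarrow> reduce w \<in> words n"
proof (induction w)
  case (Cons x w)
  then have "fst x < n" "w \<in> words n"
    by (auto simp: words_def)
  with Cons.IH show ?case
    by (simp add: reduce_def words_cons_red)
qed (simp add: reduce_def)

lemma words_word_inv: "w \<in> words n \<Longrightarrow> word_inv w \<in> words n"
  by (auto simp: words_def word_inv_def flip_def)

lemma reduce_word_inv_append: "reduce (word_inv w @ w) = []"
proof (induction w)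
  case (Cons a w)
  have "cons_red (flip a) (cons_red a (reduce w)) = reduce w"
    using cons_red_flip[of "reduce w" "flip a"] by (simp add: reduced_reduce)
  with Cons show ?case
    by (simp add: word_inv_def reduce_def)
qed (simp add: word_inv_def reduce_def)

lemma gen_in_free_group: "i < n \<Longrightarrow> gen i \<in> carrier (free_group n)"
  by (auto simp: free_group_def gen_def words_def reduced_def)

theorem group_free_group: "group (free_group n)"
proof (rule groupI)
  fix x assume "x \<in> carrier (free_group n)"
  then have "reduce (word_inv x) \<in> carrier (free_group n)"
    and "reduce (word_inv x) \<otimes>\<^bsub>free_group n\<^esub> x = \<one>\<^bsub>free_group n\<^esub>"
    by (auto simp: free_group_def reduced_reduce words_reduce words_word_inv
        reduce_append_left reduce_word_inv_append)
  then show "\<exists>y\<in>carrier (free_group n). y \<otimes>\<^bsub>free_group n\<^esub> x = \<one>\<^bsub>free_group n\<^esub>"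
    by blast
qed (auto simp: free_group_def reduced_reduce words_reduce words_append
    reduce_append_left reduce_append_right reduce_reduced)

lemma inv_free_group:
  assumes "x \<in> carrier (free_group n)"
  shows "inv\<^bsub>free_group n\<^esub> x = word_inv x"
proof -
  have "successively (\<lambda>a b. b \<noteq> flip a) (rev (map flip x))"
    using assms by (auto simp: free_group_def reduced_def successively_map flip_eq_iff
        elim!: successively_mono)
  then have "word_inv x \<in> carrier (free_group n)"
    using assms by (auto simp: free_group_def reduced_def word_inv_def[symmetric] words_word_inv)
  moreover have "word_inv x \<otimes>\<^bsub>free_group n\<^esub> x = \<one>\<^bsub>free_group n\<^esub>"
    by (simp add: free_group_def reduce_word_inv_append)
  ultimately show ?thesis
    using assms group.inv_equality[OF group_free_group] by blast
qed


section \<open>Remnant\<close>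

text \<open>
  If \<open>x\<close> and \<open>y\<close> are reduced, then the initial segment of \<open>y\<close> that cancels in the product \<open>x y\<close>
  is the longest prefix \<open>s\<close> of \<open>y\<close> such that \<open>x\<close> ends in the inverse of \<open>s\<close>.  The terminal
  segment of \<open>x\<close> that cancels has the same length.
\<close>

definition cancel_length :: "word \<Rightarrow> word \<Rightarrow> nat" where
  "cancel_length x y = length (longest_common_prefix (word_inv x) y)"

definition exponents :: "nat \<Rightarrow> nat \<Rightarrow> int set" where
  "exponents i j = (if j = i then {0, 1} else {-1, 0, 1})"

text \<open>
  Below, \<open>h 0, \<dots>, h (n - 1)\<close> is a tuple of elements of the free group of rank \<open>m\<close>, and \<open>i < n\<close>.
\<close>

definition initial_cancel :: "nat \<Rightarrow> nat \<Rightarrow> (nat \<Rightarrow> word) \<Rightarrow> nat \<Rightarrow> nat" where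
  "initial_cancel m n h i =
     Max {cancel_length (h j [^]\<^bsub>free_group m\<^esub> \<alpha>) (h i) | j \<alpha>. j < n \<and> \<alpha> \<in> exponents i j}"

definition terminal_cancel :: "nat \<Rightarrow> nat \<Rightarrow> (nat \<Rightarrow> word) \<Rightarrow> nat \<Rightarrow> nat" where
  "terminal_cancel m n h i =
     Max {cancel_length (h i) (h k [^]\<^bsub>free_group m\<^esub> \<beta>) | k \<beta>. k < n \<and> \<beta> \<in> exponents i k}"

definition tuple_has_remnant :: "nat \<Rightarrow> nat \<Rightarrow> (nat \<Rightarrow> word) \<Rightarrow> bool" where
  "tuple_has_remnant m n h \<longleftrightarrow>
     (\<forall>i<n. initial_cancel m n h i + terminal_cancel m n h i < length (h i))"

definition tuple_remnant :: "nat \<Rightarrow> nat \<Rightarrow> (nat \<Rightarrow> word) \<Rightarrow> nat \<Rightarrow> word" where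
  "tuple_remnant m n h i =
     drop (initial_cancel m n h i) (take (length (h i) - terminal_cancel m n h i) (h i))"

text \<open>For homomorphisms from the free group of rank \<open>n\<close> to the free group of rank \<open>m\<close>.\<close>

definition has_remnant :: "nat \<Rightarrow> nat \<Rightarrow> (word \<Rightarrow> word) \<Rightarrow> bool" where
  "has_remnant n m \<phi> \<longleftrightarrow> tuple_has_remnant m n (\<lambda>i. \<phi> (gen i))"

definition Rem :: "nat \<Rightarrow> nat \<Rightarrow> (word \<Rightarrow> word) \<Rightarrow> nat \<Rightarrow> word" where
  "Rem n m \<phi> i = tuple_remnant m n (\<lambda>i. \<phi> (gen i)) i"


section \<open>Algorithms\<close>

text \<open>
  Algorithms are \<open>\<mu>\<close>-recursive programs.  The relation \<open>computes p xs y\<close> says that \<open>p\<close> halts on the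
  input \<open>xs\<close> with output \<open>y\<close>; applying a program to an input of the wrong length may have no result.
\<close>

datatype recf =
    Zero
  | Succ
  | Proj nat
  | Comp recf "recf list"
  | Prim recf recf
  | Mu recf

inductive computes :: "recf \<Rightarrow> nat list \<Rightarrow> nat \<Rightarrow> bool" where
  Zero: "computes Zero xs 0"
| Succ: "computes Succ [x] (Suc x)"
| Proj: "i < length xs \<Longrightarrow> computes (Proj i) xs (xs ! i)"
| Comp: "list_all2 (\<lambda>g y. computes g xs y) gs ys \<Longrightarrow> computes f ys z \<Longrightarrow> computes (Comp f gs) xs z"
| Prim_0: "computes f xs y \<Longrightarrow> computes (Prim f g) (0 # xs) y"
| Prim_Suc: "computes (Prim f g) (k # xs) r \<Longrightarrow> computes g (k # r # xs) y \<Longrightarrow>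
    computes (Prim f g) (Suc k # xs) y"
| Mu: "computes f (k # xs) 0 \<Longrightarrow> (\<forall>l<k. \<exists>y>0. computes f (l # xs) y) \<Longrightarrow> computes (Mu f) xs k"

theorem computes_deterministic: "computes p xs y \<Longrightarrow> computes p xs z \<Longrightarrow> y = z"
proof (induction arbitrary: z rule: computes.induct)
  case (Comp xs gs ys f w)
  from Comp.prems obtain ys' where ys': "list_all2 (\<lambda>g y. computes g xs y) gs ys'" "computes f ys' z"
    by cases auto
  have "ys = ys'"
    using Comp.IH(1) ys'(1) by (auto simp: list_all2_conv_all_nth intro!: nth_equalityI)
  with Comp.IH(2) ys'(2) show ?case by blast
next
  case (Prim_0 f xs y g)
  from Prim_0.prems have "computes f xs z"
    by cases auto
  then show ?case by (rule Prim_0.IH)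
next
  case (Prim_Suc f g k xs r y)
  from Prim_Suc.prems obtain r' where "computes (Prim f g) (k # xs) r'" "computes g (k # r' # xs) z"
    by cases auto
  with Prim_Suc.IH show ?case by blast
next
  case (Mu f k xs)
  from Mu.prems have z: "computes f (z # xs) 0" "\<forall>l<z. \<exists>y>0. computes f (l # xs) y"
    by (cases; auto)+
  show ?case
  proof (cases k z rule: linorder_cases)
    case less
    with z(2) Mu.IH(1) show ?thesis by fastforce
  next
    case greater
    with z(1) Mu.IH(2) show ?thesis by fastforce
  qed
qed (erule computes.cases; simp)+

definition letter_code :: "letter \<Rightarrow> nat" where
  "letter_code x = prod_encode (fst x, of_bool (snd x))"

definition word_code :: "word \<Rightarrow> nat" where
  "word_code w = list_encode (map letter_code w)"

lemma inj_word_code: "inj word_code"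
proof -
  have "inj letter_code"
    by (rule injI) (auto simp: letter_code_def prod_eq_iff of_bool_def split: if_splits)
  then show ?thesis
    by (auto simp: word_code_def inj_map_eq_map intro!: injI dest!: injD[OF inj_list_encode])
qed

text \<open>
  Decidability of a unary or binary predicate on the free group of rank \<open>n\<close>.  An algorithm is given
  the codes of arbitrary, not necessarily reduced, words representing the group elements.
\<close>

definition decidable1 :: "nat \<Rightarrow> (word \<Rightarrow> bool) \<Rightarrow> bool" where
  "decidable1 n P \<longleftrightarrow>
     (\<exists>p. \<forall>u\<in>words n. computes p [word_code u] (of_bool (P (reduce u))))"

definition decidable2 :: "nat \<Rightarrow> (word \<Rightarrow> word \<Rightarrow> bool) \<Rightarrow> bool" where
  "decidable2 n P \<longleftrightarrow>
     (\<exists>p. \<forall>u\<in>words n. \<forall>v\<in>words n.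
        computes p [word_code u, word_code v] (of_bool (P (reduce u) (reduce v))))"

end

(* Since the remnants survive in the image of a reduced word z, the length of phi(z) is at least the
   sum of the remnant lengths of its letters, hence at least |z| + |psi(z)|.  If u = phi(z) v psi(z)^-1,
   then |phi(z)| is at most |u| + |psi(z)| + |v|, so |z| is at most |u| + |v| and a bounded search
   decides.  The second part is the case where psi is the identity, with u and v exchanged; the third
   is the case where psi and v are trivial.

   On codes, reading a word from left to right and multiplying an accumulator from the left by the
   inverses of the letters computes w^-1 a.  Left division is thus the only group operation that has
   to be shown recursive, and the equation is tested as v^-1 phi(z)^-1 u psi(z) = 1. *)

theory Submission
  imports Defs
begin

section \<open>Cancellation\<close>

lemma word_inv_append: "word_inv (x @ y) = word_inv y @ word_inv x"
  by (simp add: word_inv_def)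

lemma word_inv_word_inv [simp]: "word_inv (word_inv x) = x"
  by (simp add: word_inv_def rev_map comp_def)

lemma length_word_inv [simp]: "length (word_inv x) = length x"
  by (simp add: word_inv_def)

lemma word_inv_concat: "word_inv (concat ws) = concat (map word_inv (rev ws))"
  by (induction ws) (auto simp: word_inv_append, simp add: word_inv_def)

lemma reduced_append:
  "reduced (x @ y) \<longleftrightarrow> reduced x \<and> reduced y \<and> (x = [] \<or> y = [] \<or> hd y \<noteq> flip (last x))"
  by (auto simp: reduced_def successively_append_iff)

lemma length_reduce_le: "length (reduce w) \<le> length w"
proof (induction w)
  case (Cons x w)
  have "length (reduce (x # w)) \<le> Suc (length (reduce w))"
    by (auto simp: reduce_def cons_red_def split: list.splits)
  with Cons show ?case by simp
qed (simp add: reduce_def)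

lemma reduce_cancel: "reduce (x @ word_inv s @ s @ y) = reduce (x @ y)"
  using reduce_append_left[of "word_inv s @ s" y] reduce_word_inv_append[of s]
  by (metis append.assoc append_Nil reduce_append_right)

lemma longest_common_prefix_commute: "longest_common_prefix x y = longest_common_prefix y x"
  by (induction x y rule: longest_common_prefix.induct) auto

text \<open>Inverting a product mirrors its seam. This later turns cancellation at the end of an
  image into cancellation at the beginning of its inverse, so that inverse generators need no
  separate analysis.\<close>

lemma cancel_length_word_inv: "cancel_length (word_inv y) (word_inv x) = cancel_length x y"
  by (simp add: cancel_length_def longest_common_prefix_commute)

text \<open>The comparison stops strictly inside \<open>p\<close>, at a mismatch or at the end of
  \<open>a\<close>, so what follows \<open>p\<close> has no influence. If it reached the end of
  \<open>p\<close>, it could continue differently in \<open>s\<close> and \<open>t\<close>.\<close>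

lemma longest_common_prefix_append_cong:
  "length (longest_common_prefix a (p @ s)) < length p \<Longrightarrow>
    longest_common_prefix a (p @ t) = longest_common_prefix a (p @ s)"
proof (induction p arbitrary: a)
  case (Cons x p)
  then show ?case by (cases a) auto
qed simp

text \<open>Remove the longest common prefix of \<open>word_inv x\<close> and \<open>y\<close> from
  both sides of the seam. A further cancelling pair there would give a longer common prefix, so the
  rest is reduced and \<open>cancel_length\<close> counts exactly the letters lost on each
  side.\<close>

lemma reduce_append_reduced:
  assumes "reduced x" "reduced y"
  shows "reduce (x @ y) =
    take (length x - cancel_length x y) x @ drop (cancel_length x y) y"
proof -
  define s where "s = longest_common_prefix (word_inv x) y"
  obtain x' where "word_inv x = s @ x'"
    using longest_common_prefix_prefix1[of "word_inv x" y] unfolding s_def prefix_def by blast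
  then have x: "x = word_inv x' @ word_inv s"
    using word_inv_append word_inv_word_inv by metis
  obtain y' where y: "y = s @ y'"
    using longest_common_prefix_prefix2[of "word_inv x" y] unfolding s_def prefix_def by blast
  have "hd y' \<noteq> flip (last (word_inv x'))" if "word_inv x' \<noteq> []" "y' \<noteq> []"
  proof
    assume *: "hd y' = flip (last (word_inv x'))"
    have "x' \<noteq> []"
      using that by (auto simp: word_inv_def)
    then have "last (word_inv x') = flip (hd x')"
      by (simp add: word_inv_def last_rev hd_map)
    with * have "hd y' = hd x'" by simp
    then have "prefix (s @ [hd y']) y" "prefix (s @ [hd y']) (word_inv x)"
      using that \<open>x' \<noteq> []\<close> \<open>word_inv x = s @ x'\<close> y
      by (metis append_Cons append_eq_append_conv2 append_self_conv append_assoc list.collapse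
          prefix_def append_Nil)+
    then have "prefix (s @ [hd y']) s"
      unfolding s_def using longest_common_prefix_max_prefix by blast
    then show False
      using prefix_length_le by fastforce
  qed
  then have "reduced (word_inv x' @ y')"
    using assms x y by (auto simp: reduced_append)
  then have "reduce (x @ y) = word_inv x' @ y'"
    using reduce_cancel[of "word_inv x'" s y'] x y by (simp add: reduce_reduced)
  moreover have "cancel_length x y = length s"
    by (simp add: cancel_length_def s_def)
  ultimately show ?thesis
    using x y by simp
qed

section \<open>Length of the image of a reduced word\<close>

text \<open>The prefix of the image is not touched by a further multiplication from the left, so the
  induction only has to follow the cancellation at one seam.\<close>

lemma reduce_image_prefix_length:
  fixes h :: "letter \<Rightarrow> word" and s t :: "letter \<Rightarrow> nat"
  assumes red: "\<And>x. x \<in> A \<Longrightarrow> reduced (h x)"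
    and less: "\<And>x. x \<in> A \<Longrightarrow> s x + t x < length (h x)"
    and cancel: "\<And>x y. x \<in> A \<Longrightarrow> y \<in> A \<Longrightarrow> y \<noteq> flip x \<Longrightarrow>
      cancel_length (h x) (h y) \<le> s y \<and> cancel_length (h x) (h y) \<le> t x"
    and "set (x # w) \<subseteq> A" "reduced (x # w)"
  shows "prefix (take (length (h x) - t x) (h x)) (reduce (concat (map h (x # w)))) \<and>
    s x + (\<Sum>y\<leftarrow>x # w. length (h y) - s y - t y) \<le> length (reduce (concat (map h (x # w))))"
  using assms(4,5)
proof (induction w arbitrary: x)
  case Nil
  then show ?case
    using red[of x] less[of x] by (auto simp: reduce_reduced take_is_prefix)
next
  case (Cons y w)
  define V where "V = reduce (concat (map h (y # w)))"
  have A: "x \<in> A" "y \<in> A" and ne: "y \<noteq> flip x"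
    using Cons.prems by (auto simp: reduced_Cons)
  have IH: "prefix (take (length (h y) - t y) (h y)) V"
    "s y + (\<Sum>y\<leftarrow>y # w. length (h y) - s y - t y) \<le> length V"
    using Cons.IH[of y] Cons.prems unfolding V_def by (auto simp: reduced_Cons)
  define p where "p = take (length (h y) - t y) (h y)"
  define c where "c = cancel_length (h x) (h y)"
  have c: "c \<le> s y" "c \<le> t x"
    using cancel[OF A ne] by (auto simp: c_def)
  \<comment> \<open>The cancellation between \<open>h x\<close> and \<open>h y\<close> ends strictly
    inside \<open>p\<close>, because \<open>c \<le> s y\<close> and
    \<open>s y + t y < length (h y)\<close>. Since \<open>V\<close> also begins with
    \<open>p\<close>, multiplying \<open>V\<close> by \<open>h x\<close> cancels the same
    \<open>c\<close> letters.\<close>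
  have "c < length p"
    using c(1) less[OF A(2)] by (simp add: p_def)
  moreover have "h y = p @ drop (length (h y) - t y) (h y)"
    by (simp add: p_def)
  moreover obtain V' where V': "V = p @ V'"
    using IH(1) by (auto simp: p_def prefix_def)
  ultimately have "cancel_length (h x) V = c"
    unfolding c_def cancel_length_def by (metis longest_common_prefix_append_cong)
  moreover have "reduce (concat (map h (x # y # w))) = reduce (h x @ V)"
    by (simp add: V_def reduce_append_right)
  ultimately have eq: "reduce (concat (map h (x # y # w))) =
      take (length (h x) - c) (h x) @ drop c V"
    using reduce_append_reduced[of "h x" V] red[OF A(1)] by (simp add: V_def reduced_reduce)
  have "prefix (take (length (h x) - t x) (h x)) (take (length (h x) - c) (h x))"
    using c(2) by (metis diff_le_mono2 min.absorb1 take_is_prefix take_take)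
  \<comment> \<open>The \<open>c\<close> letters cut from \<open>V\<close> are paid for by the extra
    summand \<open>s y\<close> of the induction hypothesis, those cut from \<open>h x\<close> by
    \<open>t x\<close>. The summand \<open>s x\<close> is kept in reserve for the next seam on the
    left.\<close>
  moreover have "s x + (\<Sum>y\<leftarrow>x # y # w. length (h y) - s y - t y)
      \<le> length (take (length (h x) - c) (h x) @ drop c V)"
    using IH(2) c less[OF A(1)] by simp
  ultimately show ?case
    unfolding eq by (metis prefix_append prefix_prefix)
qed

lemma reduce_image_length:
  fixes h :: "letter \<Rightarrow> word" and s t :: "letter \<Rightarrow> nat"
  assumes "\<And>x. x \<in> A \<Longrightarrow> reduced (h x)"
    and "\<And>x. x \<in> A \<Longrightarrow> s x + t x < length (h x)"
    and "\<And>x y. x \<in> A \<Longrightarrow> y \<in> A \<Longrightarrow> y \<noteq> flip x \<Longrightarrow>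
      cancel_length (h x) (h y) \<le> s y \<and> cancel_length (h x) (h y) \<le> t x"
    and "set w \<subseteq> A" "reduced w"
  shows "(\<Sum>y\<leftarrow>w. length (h y) - s y - t y) \<le> length (reduce (concat (map h w)))"
proof (cases w)
  case (Cons x v)
  then show ?thesis
    using reduce_image_prefix_length[of A h s t x v] assms by force
qed simp

section \<open>Homomorphisms of free groups\<close>

lemma carrier_free_group: "w \<in> carrier (free_group n) \<longleftrightarrow> w \<in> words n \<and> reduced w"
  by (simp add: free_group_def)

lemma mult_free_group: "x \<otimes>\<^bsub>free_group n\<^esub> y = reduce (x @ y)"
  by (simp add: free_group_def)

lemma one_free_group: "\<one>\<^bsub>free_group n\<^esub> = []"
  by (simp add: free_group_def)

lemma letter_in_free_group: "fst x < n \<Longrightarrow> [x] \<in> carrier (free_group n)"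
  by (simp add: carrier_free_group words_def reduced_Cons)

lemma reduce_in_free_group: "w \<in> words n \<Longrightarrow> reduce w \<in> carrier (free_group n)"
  by (simp add: carrier_free_group words_reduce reduced_reduce)

lemma hom_free_group:
  "\<phi> \<in> hom (free_group n) (free_group m) \<Longrightarrow> group_hom (free_group n) (free_group m) \<phi>"
  by (simp add: group_hom_def group_hom_axioms_def group_free_group)

lemma hom_letter_flip:
  assumes "\<phi> \<in> hom (free_group n) (free_group m)" "fst x < n"
  shows "\<phi> [flip x] = word_inv (\<phi> [x])"
proof -
  interpret group_hom "free_group n" "free_group m" \<phi>
    using assms(1) by (rule hom_free_group)
  have "inv\<^bsub>free_group n\<^esub> [x] = [flip x]"
    using letter_in_free_group[OF assms(2)] by (simp add: inv_free_group word_inv_def)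
  then show ?thesis
    using letter_in_free_group[OF assms(2)] by (metis hom_closed hom_inv inv_free_group)
qed

lemma hom_reduce:
  assumes "\<phi> \<in> hom (free_group n) (free_group m)" "w \<in> words n"
  shows "\<phi> (reduce w) = reduce (concat (map (\<lambda>x. \<phi> [x]) w))"
proof -
  interpret group_hom "free_group n" "free_group m" \<phi>
    using assms(1) by (rule hom_free_group)
  show ?thesis
    using assms(2)
  proof (induction w)
    case Nil
    then show ?case
      using hom_one by (simp add: reduce_def one_free_group)
  next
    case (Cons x w)
    then have w: "fst x < n" "w \<in> words n"
      by (auto simp: words_def)
    have "\<phi> (reduce (x # w)) = \<phi> ([x] \<otimes>\<^bsub>free_group n\<^esub> reduce w)"
      using reduce_append_right[of "[x]" w] by (simp add: mult_free_group)
    also have "\<dots> = reduce (\<phi> [x] @ \<phi> (reduce w))"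
      using hom_mult[OF letter_in_free_group[OF w(1)] reduce_in_free_group[OF w(2)]]
      by (simp add: mult_free_group)
    finally show ?case
      using Cons.IH w(2) by (simp add: reduce_append_right)
  qed
qed

lemma length_hom_le:
  assumes "\<phi> \<in> hom (free_group n) (free_group m)" "z \<in> carrier (free_group n)"
  shows "length (\<phi> z) \<le> (\<Sum>x\<leftarrow>z. length (\<phi> [x]))"
proof -
  have "\<phi> z = reduce (concat (map (\<lambda>x. \<phi> [x]) z))"
    using hom_reduce[OF assms(1), of z] assms(2) by (simp add: carrier_free_group reduce_reduced)
  also have "length \<dots> \<le> length (concat (map (\<lambda>x. \<phi> [x]) z))"
    by (rule length_reduce_le)
  finally show ?thesis
    by (simp add: length_concat comp_def)
qed

section \<open>Remnant\<close>

lemma finite_exponents: "finite (exponents i j)"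
  by (simp add: exponents_def)

lemma cancel_le_initial_cancel:
  assumes "j < n" "\<alpha> \<in> exponents i j"
  shows "cancel_length (h j [^]\<^bsub>free_group m\<^esub> \<alpha>) (h i) \<le> initial_cancel m n h i"
  unfolding initial_cancel_def
proof (rule Max_ge)
  \<comment> \<open>\<open>Max\<close> is known to dominate only the members of a finite set;
    finiteness is read off from a presentation as the image of a finite set of pairs.\<close>
  have "{cancel_length (h j [^]\<^bsub>free_group m\<^esub> \<alpha>) (h i) | j \<alpha>. j < n \<and> \<alpha> \<in> exponents i j} =
    (\<lambda>(j, \<alpha>). cancel_length (h j [^]\<^bsub>free_group m\<^esub> \<alpha>) (h i)) ` (SIGMA j:{..<n}. exponents i j)"
    by auto
  then show "finite {cancel_length (h j [^]\<^bsub>free_group m\<^esub> \<alpha>) (h i) | j \<alpha>. j < n \<and> \<alpha> \<in> exponents i j}"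
    by (simp add: finite_exponents)
qed (use assms in blast)

lemma cancel_le_terminal_cancel:
  assumes "k < n" "\<beta> \<in> exponents i k"
  shows "cancel_length (h i) (h k [^]\<^bsub>free_group m\<^esub> \<beta>) \<le> terminal_cancel m n h i"
  unfolding terminal_cancel_def
proof (rule Max_ge)
  have "{cancel_length (h i) (h k [^]\<^bsub>free_group m\<^esub> \<beta>) | k \<beta>. k < n \<and> \<beta> \<in> exponents i k} =
    (\<lambda>(k, \<beta>). cancel_length (h i) (h k [^]\<^bsub>free_group m\<^esub> \<beta>)) ` (SIGMA k:{..<n}. exponents i k)"
    by auto
  then show "finite {cancel_length (h i) (h k [^]\<^bsub>free_group m\<^esub> \<beta>) | k \<beta>. k < n \<and> \<beta> \<in> exponents i k}"
    by (simp add: finite_exponents)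
qed (use assms in blast)

text \<open>The allowance for cancellation at the beginning of the image of the letter
  \<open>x\<close>. The beginning of the inverse of a word is its inverted end, hence
  \<open>terminal_cancel\<close> for inverse generators; the allowance at the end of the image of
  \<open>x\<close> is the value at \<open>flip x\<close>.\<close>

definition letter_cancel :: "nat \<Rightarrow> nat \<Rightarrow> (word \<Rightarrow> word) \<Rightarrow> letter \<Rightarrow> nat" where
  "letter_cancel n m \<phi> x =
    (if snd x then initial_cancel m n (\<lambda>i. \<phi> (gen i)) (fst x)
     else terminal_cancel m n (\<lambda>i. \<phi> (gen i)) (fst x))"

lemma hom_letter:
  assumes "\<phi> \<in> hom (free_group n) (free_group m)" "fst x < n"
  shows "\<phi> [x] = (if snd x then \<phi> (gen (fst x)) else word_inv (\<phi> (gen (fst x))))"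
  using hom_letter_flip[OF assms(1), of "(fst x, True)"] assms(2)
  by (cases x) (auto simp: gen_def flip_def)

text \<open>Brings the images of letters into the form of powers in which
  \<open>initial_cancel\<close> and \<open>terminal_cancel\<close> are stated.\<close>

lemma hom_letter_pow:
  assumes "\<phi> \<in> hom (free_group n) (free_group m)" "fst x < n"
  shows "\<phi> [x] = \<phi> (gen (fst x)) [^]\<^bsub>free_group m\<^esub> (if snd x then 1 else -1 :: int)"
proof -
  interpret group_hom "free_group n" "free_group m" \<phi>
    using assms(1) by (rule hom_free_group)
  have "\<phi> (gen (fst x)) \<in> carrier (free_group m)"
    using assms(2) by (simp add: gen_in_free_group)
  then show ?thesis
    using hom_letter[OF assms] inv_free_group H.int_pow_neg_int[of "\<phi> (gen (fst x))" 1]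
    by (auto simp: H.int_pow_1 H.int_pow_neg)
qed

lemma cancel_le_letter_cancel:
  assumes hom: "\<phi> \<in> hom (free_group n) (free_group m)"
    and x: "fst x < n" and y: "fst y < n" and ne: "y \<noteq> flip x"
  shows "cancel_length (\<phi> [x]) (\<phi> [y]) \<le> letter_cancel n m \<phi> y"
proof (cases "snd y")
  case True
  \<comment> \<open>If \<open>x\<close> and \<open>y\<close> belong to the same generator,
    \<open>y \<noteq> flip x\<close> forces equal signs. The exponent is then 1, so the excluded
    exponent -1 does not occur.\<close>
  have "(if snd x then 1 else -1) \<in> exponents (fst y) (fst x)"
    using ne True by (auto simp: exponents_def flip_def prod_eq_iff)
  from cancel_le_initial_cancel[where h = "\<lambda>i. \<phi> (gen i)", OF x this] show ?thesis
    using hom_letter_pow[OF hom x] hom_letter[OF hom y] True by (simp add: letter_cancel_def)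
next
  case False
  \<comment> \<open>Here \<open>y\<close> is an inverse generator. The inverse of the product has
    the generator of \<open>y\<close> on the left and \<open>flip x\<close> on the right, so the
    bound on terminal cancellation applies.\<close>
  have "(if snd (flip x) then 1 else -1) \<in> exponents (fst y) (fst (flip x))"
    using ne False by (auto simp: exponents_def flip_def prod_eq_iff)
  moreover have "fst (flip x) < n"
    using x by (simp add: flip_def)
  ultimately have "cancel_length (\<phi> (gen (fst y))) (\<phi> [flip x]) \<le> letter_cancel n m \<phi> y"
    using cancel_le_terminal_cancel[where h = "\<lambda>i. \<phi> (gen i)"] hom_letter_pow[OF hom, of "flip x"] False
    by (fastforce simp: letter_cancel_def)
  moreover have "\<phi> [flip x] = word_inv (\<phi> [x])" "\<phi> (gen (fst y)) = word_inv (\<phi> [y])"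
    using hom_letter_flip[OF hom x] hom_letter[OF hom y] False by simp_all
  ultimately show ?thesis
    by (simp add: cancel_length_word_inv)
qed

lemma length_Rem:
  "length (Rem n m \<phi> i) = length (\<phi> (gen i)) - initial_cancel m n (\<lambda>i. \<phi> (gen i)) i
    - terminal_cancel m n (\<lambda>i. \<phi> (gen i)) i"
  by (simp add: Rem_def tuple_remnant_def)

lemma length_hom_ge:
  assumes hom: "\<phi> \<in> hom (free_group n) (free_group m)" and rem: "has_remnant n m \<phi>"
    and z: "z \<in> carrier (free_group n)"
  shows "(\<Sum>x\<leftarrow>z. length (Rem n m \<phi> (fst x))) \<le> length (\<phi> z)"
proof -
  let ?s = "letter_cancel n m \<phi>"
  let ?t = "\<lambda>x. ?s (flip x)"
  interpret group_hom "free_group n" "free_group m" \<phi>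
    using hom by (rule hom_free_group)
  have z': "set z \<subseteq> {x. fst x < n}" "reduced z"
    using z by (auto simp: carrier_free_group words_def)
  \<comment> \<open>For an inverse generator \<open>?s\<close> and \<open>?t\<close> exchange their
    values, which does not affect the difference.\<close>
  have Rem: "length (\<phi> [x]) - ?s x - ?t x = length (Rem n m \<phi> (fst x))" if "fst x < n" for x
    using hom_letter[OF hom that] by (auto simp: length_Rem letter_cancel_def flip_def)
  have "(\<Sum>x\<leftarrow>z. length (\<phi> [x]) - ?s x - ?t x) \<le> length (reduce (concat (map (\<lambda>x. \<phi> [x]) z)))"
  proof (rule reduce_image_length[where A = "{x. fst x < n}"])
    fix x :: letter assume "x \<in> {x. fst x < n}"
    then have x: "fst x < n" by simp
    show "reduced (\<phi> [x])"
      using hom_closed[OF letter_in_free_group[OF x]] by (simp add: carrier_free_group)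
    show "?s x + ?t x < length (\<phi> [x])"
      using rem x hom_letter[OF hom x]
      by (auto simp: has_remnant_def tuple_has_remnant_def letter_cancel_def flip_def add.commute)
    fix y :: letter assume "y \<in> {x. fst x < n}" "y \<noteq> flip x"
    then have y: "fst y < n" "y \<noteq> flip x" "flip x \<noteq> flip (flip y)" by auto
    \<comment> \<open>The bound by \<open>?t x\<close> comes from the mirrored product, in which the
      image of \<open>flip y\<close> is followed by that of \<open>flip x\<close>.\<close>
    have "fst (flip x) < n" "fst (flip y) < n"
      using x y by (auto simp: flip_def)
    from cancel_le_letter_cancel[OF hom this(2,1) y(3)]
    show "cancel_length (\<phi> [x]) (\<phi> [y]) \<le> ?s y \<and> cancel_length (\<phi> [x]) (\<phi> [y]) \<le> ?t x"
      using cancel_le_letter_cancel[OF hom x y(1,2)]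
      by (simp add: hom_letter_flip[OF hom] x y cancel_length_word_inv)
  qed (use z' in auto)
  also have "reduce (concat (map (\<lambda>x. \<phi> [x]) z)) = \<phi> z"
    using hom_reduce[OF hom, of z] z by (simp add: carrier_free_group reduce_reduced)
  also have "(\<Sum>x\<leftarrow>z. length (\<phi> [x]) - ?s x - ?t x) = (\<Sum>x\<leftarrow>z. length (Rem n m \<phi> (fst x)))"
    using z'(1) by (intro arg_cong[of _ _ sum_list] map_cong refl Rem) auto
  finally show ?thesis .
qed

section \<open>Length bound for solutions of the twisted equation\<close>

lemma length_hom_letter:
  assumes "\<phi> \<in> hom (free_group n) (free_group m)" "fst x < n"
  shows "length (\<phi> [x]) = length (\<phi> (gen (fst x)))"
  using hom_letter[OF assms] by simp

lemma twisted_conjugator_length: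
  assumes \<phi>: "\<phi> \<in> hom (free_group n) (free_group m)" and \<psi>: "\<psi> \<in> hom (free_group n) (free_group m)"
    and rem: "has_remnant n m \<phi>" and less: "\<forall>i<n. length (Rem n m \<phi> i) > length (\<psi> (gen i))"
    and z: "z \<in> carrier (free_group n)"
    and u: "u \<in> carrier (free_group m)" and v: "v \<in> carrier (free_group m)"
    and eq: "u = \<phi> z \<otimes>\<^bsub>free_group m\<^esub> v \<otimes>\<^bsub>free_group m\<^esub> inv\<^bsub>free_group m\<^esub> (\<psi> z)"
  shows "length z \<le> length u + length v"
proof -
  interpret \<phi>: group_hom "free_group n" "free_group m" \<phi>
    using \<phi> by (rule hom_free_group)
  interpret \<psi>: group_hom "free_group n" "free_group m" \<psi>
    using \<psi> by (rule hom_free_group)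
  have cl: "\<phi> z \<in> carrier (free_group m)" "\<psi> z \<in> carrier (free_group m)"
    using z by simp_all
  have "\<phi> z = u \<otimes>\<^bsub>free_group m\<^esub> \<psi> z \<otimes>\<^bsub>free_group m\<^esub> inv\<^bsub>free_group m\<^esub> v"
    using eq cl u v
    by (metis \<phi>.H.inv_solve_right \<phi>.H.inv_solve_right' \<phi>.H.m_closed \<phi>.H.inv_closed)
  then have "\<phi> z = reduce (u @ \<psi> z @ word_inv v)"
    using v by (simp add: inv_free_group mult_free_group reduce_append_left)
  then have "length (\<phi> z) \<le> length u + length (\<psi> z) + length v"
    using length_reduce_le[of "u @ \<psi> z @ word_inv v"] by simp
  moreover have "length z + length (\<psi> z) \<le> length (\<phi> z)"
  proof -
    have zn: "\<And>x. x \<in> set z \<Longrightarrow> fst x < n"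
      using z by (auto simp: carrier_free_group words_def)
    have "length z + length (\<psi> z) \<le> length z + (\<Sum>x\<leftarrow>z. length (\<psi> [x]))"
      using length_hom_le[OF \<psi> z] by simp
    \<comment> \<open>The strict inequality between the remnants and the images under
      \<open>\<psi>\<close> leaves a surplus of one for every letter of \<open>z\<close>; these add
      up to \<open>length z\<close>.\<close>
    also have "\<dots> = (\<Sum>x\<leftarrow>z. Suc (length (\<psi> [x])))"
      by (induction z) auto
    also have "\<dots> \<le> (\<Sum>x\<leftarrow>z. length (Rem n m \<phi> (fst x)))"
      using less zn by (intro sum_list_mono) (auto simp: length_hom_letter[OF \<psi>] Suc_le_eq)
    finally show ?thesis
      using length_hom_ge[OF \<phi> rem z] by simp
  qed
  ultimately show ?thesis
    by simp
qed

section \<open>Recursive functions\<close>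

text \<open>Total recursive functions of \<open>k\<close> arguments, packed into a list as programs
  expect them. Values at lists of other lengths are left free, so totally defined HOL expressions
  such as \<open>xs ! i\<close> can be used directly.\<close>

definition recfun :: "nat \<Rightarrow> (nat list \<Rightarrow> nat) \<Rightarrow> bool" where
  "recfun k f \<longleftrightarrow> (\<exists>p. \<forall>xs. length xs = k \<longrightarrow> computes p xs (f xs))"

lemma recfunI: "(\<And>xs. length xs = k \<Longrightarrow> computes p xs (f xs)) \<Longrightarrow> recfun k f"
  unfolding recfun_def by blast

lemma recfun_cong:
  "recfun k f \<Longrightarrow> (\<And>xs. length xs = k \<Longrightarrow> f xs = g xs) \<Longrightarrow> recfun k g"
  unfolding recfun_def by metis

lemma recfun_nth: "i < k \<Longrightarrow> recfun k (\<lambda>xs. xs ! i)"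
  using computes.Proj by (intro recfunI) auto

lemma recfun_comp:
  assumes f: "recfun (length gs) f" and gs: "\<And>g. g \<in> set gs \<Longrightarrow> recfun k g"
  shows "recfun k (\<lambda>xs. f (map (\<lambda>g. g xs) gs))"
proof -
  obtain p where p: "\<And>xs. length xs = length gs \<Longrightarrow> computes p xs (f xs)"
    using f unfolding recfun_def by blast
  have "\<forall>g. \<exists>q. g \<in> set gs \<longrightarrow> (\<forall>xs. length xs = k \<longrightarrow> computes q xs (g xs))"
    using gs unfolding recfun_def by blast
  then obtain q where q: "\<And>g xs. g \<in> set gs \<Longrightarrow> length xs = k \<Longrightarrow> computes (q g) xs (g xs)"
    by metis
  show ?thesis
  proof (rule recfunI)
    fix xs :: "nat list" assume "length xs = k"
    then show "computes (Comp p (map q gs)) xs (f (map (\<lambda>g. g xs) gs))"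
      using p q by (intro computes.Comp[where ys = "map (\<lambda>g. g xs) gs"])
        (auto simp: list_all2_conv_all_nth)
  qed
qed

lemma recfun_comp1: "recfun 1 f \<Longrightarrow> recfun k g \<Longrightarrow> recfun k (\<lambda>xs. f [g xs])"
  using recfun_comp[of "[g]" f k] by simp

lemma recfun_comp2:
  "recfun 2 f \<Longrightarrow> recfun k g \<Longrightarrow> recfun k h \<Longrightarrow> recfun k (\<lambda>xs. f [g xs, h xs])"
  using recfun_comp[of "[g, h]" f k] by (auto simp: numeral_2_eq_2)

lemma recfun_comp3:
  "recfun 3 f \<Longrightarrow> recfun k g \<Longrightarrow> recfun k h \<Longrightarrow> recfun k i \<Longrightarrow>
    recfun k (\<lambda>xs. f [g xs, h xs, i xs])"
  using recfun_comp[of "[g, h, i]" f k] by (auto simp: numeral_3_eq_3)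

text \<open>Follows the calling convention of \<open>Prim\<close>: recursion on the first argument,
  and a step that receives the counter, the previous value and the parameters in this order. For a
  given \<open>f\<close> only the two recursion equations remain to be checked.\<close>

lemma recfun_prim:
  assumes a: "recfun k a" and b: "recfun (Suc (Suc k)) b"
    and f: "\<And>xs. length xs = k \<Longrightarrow> f (0 # xs) = a xs"
      "\<And>i xs. length xs = k \<Longrightarrow> f (Suc i # xs) = b (i # f (i # xs) # xs)"
  shows "recfun (Suc k) f"
proof -
  obtain p where p: "\<And>xs. length xs = k \<Longrightarrow> computes p xs (a xs)"
    using a unfolding recfun_def by blast
  obtain q where q: "\<And>xs. length xs = Suc (Suc k) \<Longrightarrow> computes q xs (b xs)"
    using b unfolding recfun_def by blast
  have *: "computes (Prim p q) (i # xs) (f (i # xs))" if "length xs = k" for i xs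
  proof (induction i)
    case 0
    show ?case
      using p f that by (auto intro!: computes.Prim_0)
  next
    case (Suc i)
    then show ?case
      using q[of "i # f (i # xs) # xs"] that by (auto simp: f intro: computes.Prim_Suc)
  qed
  show ?thesis
  proof (rule recfunI)
    fix xs :: "nat list" assume "length xs = Suc k"
    then show "computes (Prim p q) xs (f xs)"
      using * by (cases xs) auto
  qed
qed

section \<open>Arithmetic, case distinction and bounded search\<close>

lemma recfun_Suc: "recfun k f \<Longrightarrow> recfun k (\<lambda>xs. Suc (f xs))"
proof -
  assume f: "recfun k f"
  have "recfun 1 (\<lambda>xs. Suc (xs ! 0))"
    using computes.Succ by (intro recfunI) (auto simp: length_Suc_conv)
  from recfun_comp1[OF this f] show ?thesis by simp
qed

lemma recfun_const: "recfun k (\<lambda>_. c)"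
proof (induction c)
  case 0
  show ?case
    using computes.Zero by (intro recfunI)
qed (rule recfun_Suc)

lemma recfun_prim1:
  fixes F :: "nat \<Rightarrow> nat \<Rightarrow> nat"
  assumes "recfun 1 (\<lambda>xs. a (xs ! 0))" "recfun 3 (\<lambda>xs. b (xs ! 0) (xs ! 1) (xs ! 2))"
    and "\<And>x. F 0 x = a x" "\<And>i x. F (Suc i) x = b i (F i x) x"
    and "recfun k g" "recfun k h"
  shows "recfun k (\<lambda>xs. F (g xs) (h xs))"
proof -
  have "recfun (Suc 1) (\<lambda>xs. F (xs ! 0) (xs ! 1))"
    by (rule recfun_prim[where a = "\<lambda>xs. a (xs ! 0)" and b = "\<lambda>xs. b (xs ! 0) (xs ! 1) (xs ! 2)"])
      (use assms in \<open>simp_all add: numeral_3_eq_3\<close>)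
  \<comment> \<open>The folding turns the arity \<open>Suc 1\<close> into the numeral
    \<open>2\<close> expected by \<open>recfun_comp2\<close>.\<close>
  from recfun_comp2[OF this[folded numeral_2_eq_2[unfolded One_nat_def[symmetric]]] assms(5,6)]
  show ?thesis by simp
qed

lemma recfun_prim0:
  fixes F :: "nat \<Rightarrow> nat"
  assumes "recfun 3 (\<lambda>xs. b (xs ! 0) (xs ! 1))" "\<And>i. F (Suc i) = b i (F i)" "recfun k g"
  shows "recfun k (\<lambda>xs. F (g xs))"
  by (rule recfun_prim1[where F = "\<lambda>i _. F i" and a = "\<lambda>_. F 0" and b = "\<lambda>i r _. b i r" and h = g])
    (use assms in \<open>simp_all add: recfun_const\<close>)

lemmas recfun_basic = recfun_const recfun_nth recfun_Suc

lemma recfun_pred: "recfun k f \<Longrightarrow> recfun k (\<lambda>xs. f xs - 1)"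
  by (rule recfun_prim0[where b = "\<lambda>i r. i"]) (auto intro!: recfun_basic)

lemma recfun_add: "recfun k f \<Longrightarrow> recfun k g \<Longrightarrow> recfun k (\<lambda>xs. f xs + g xs)"
  by (rule recfun_prim1[where a = "\<lambda>x. x" and b = "\<lambda>i r x. Suc r"]) (auto intro!: recfun_basic)

lemma recfun_diff: "recfun k f \<Longrightarrow> recfun k g \<Longrightarrow> recfun k (\<lambda>xs. f xs - g xs)"
  \<comment> \<open>The recursion runs over the subtrahend, with truncated subtraction as iterated
    predecessor; hence the swapped arguments of \<open>F\<close>.\<close>
  by (rule recfun_prim1[where F = "\<lambda>x y. y - x" and a = "\<lambda>x. x" and b = "\<lambda>i r x. r - 1"])
    (simp_all add: recfun_basic recfun_pred[of _ "\<lambda>xs. xs ! 1", simplified])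

lemma recfun_if_zero:
  assumes "recfun k c" "recfun k f" "recfun k g"
  shows "recfun k (\<lambda>xs. if c xs = 0 then f xs else g xs)"
proof -
  have "recfun (Suc 2) (\<lambda>xs. if xs ! 0 = 0 then xs ! 1 else xs ! 2)"
    \<comment> \<open>The condition is the recursion argument. The step sees the counter and the
      previous value before the two branches, so the second branch has index 3.\<close>
    by (rule recfun_prim[where a = "\<lambda>xs. xs ! 0" and b = "\<lambda>xs. xs ! 3"])
      (auto intro!: recfun_basic)
  then have "recfun 3 (\<lambda>xs. if xs ! 0 = 0 then xs ! 1 else xs ! 2)"
    by simp
  from recfun_comp3[OF this assms] show ?thesis by (simp cong: if_cong)
qed

lemma recfun_if_le:
  assumes "recfun k a" "recfun k b" "recfun k f" "recfun k g"
  shows "recfun k (\<lambda>xs. if a xs \<le> b xs then f xs else g xs)"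
  using recfun_if_zero[OF recfun_diff[OF assms(1,2)] assms(3,4)] by simp

lemma recfun_if_eq:
  assumes "recfun k a" "recfun k b" "recfun k f" "recfun k g"
  shows "recfun k (\<lambda>xs. if a xs = b xs then f xs else g xs)"
  by (rule recfun_cong[OF recfun_if_le[OF assms(1,2) recfun_if_le[OF assms(2,1,3,4)] assms(4)]]) auto

text \<open>Primitive recursion on the bound: the flag becomes 1 at the first zero of
  \<open>t\<close> and is carried along from then on.\<close>

lemma recfun_bounded_ex:
  assumes "recfun (Suc k) t" "recfun k f"
  shows "recfun k (\<lambda>xs. of_bool (\<exists>j<f xs. t (j # xs) = 0))"
proof -
  let ?E = "\<lambda>xs. of_bool (\<exists>j<hd xs. t (j # tl xs) = 0)"
  \<comment> \<open>The recursion step also receives the previous flag, in position 1.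
    \<open>t'\<close> is \<open>t\<close> with that position skipped.\<close>
  define t' where
    "t' xs = t (map (\<lambda>g. g xs) ((\<lambda>xs. xs ! 0) # map (\<lambda>i xs. xs ! (i + 2)) [0..<k]))" for xs
  have "recfun (Suc (Suc k)) t'"
    unfolding t'_def by (rule recfun_comp) (use assms(1) in \<open>auto intro!: recfun_nth\<close>)
  then have b: "recfun (Suc (Suc k)) (\<lambda>xs. if t' xs = 0 then 1 else xs ! 1)"
    by (intro recfun_if_zero) (auto intro!: recfun_basic)
  have t': "t' (i # r # xs) = t (i # xs)" if "length xs = k" for i r xs
    unfolding t'_def using that by (auto simp: comp_def intro!: arg_cong[of _ _ t] nth_equalityI)
  have "recfun (Suc k) ?E"
    by (rule recfun_prim[OF recfun_const[of k 0] b]) (auto simp: t' less_Suc_eq)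
  \<comment> \<open>In \<open>?E\<close> the bound is the first argument; here \<open>f\<close> is
    substituted for it and the parameters are passed on by projections.\<close>
  then have "recfun k (\<lambda>xs. ?E (map (\<lambda>g. g xs) (f # map (\<lambda>i xs. xs ! i) [0..<k])))"
    by (intro recfun_comp) (use assms(2) in \<open>auto intro!: recfun_nth\<close>)
  note * = this
  have eq: "map (\<lambda>g. g xs) (f # map (\<lambda>i xs. xs ! i) [0..<k]) = f xs # xs"
    if "length xs = k" for xs
    using that by (auto simp: comp_def intro!: nth_equalityI)
  show ?thesis
    by (rule recfun_cong[OF *]) (simp only: eq list.sel)
qed

section \<open>Recursive functions on codes of lists\<close>

lemma recfun_triangle: "recfun k f \<Longrightarrow> recfun k (\<lambda>xs. triangle (f xs))"
  by (rule recfun_prim0[where b = "\<lambda>i r. r + Suc i"]) (auto intro!: recfun_basic recfun_add)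

lemma recfun_prod_encode:
  "recfun k f \<Longrightarrow> recfun k g \<Longrightarrow> recfun k (\<lambda>xs. prod_encode (f xs, g xs))"
  unfolding prod_encode_def by (auto intro!: recfun_add recfun_triangle)

text \<open>Cantor's pairing sends \<open>(a, b)\<close> to \<open>triangle (a + b) + a\<close>, so
  this is the index of the antidiagonal through \<open>n\<close>, the largest \<open>d\<close> with
  \<open>triangle d \<le> n\<close>. Once it is recursive, both components of
  \<open>prod_decode\<close> are obtained by subtraction.\<close>

definition diagonal :: "nat \<Rightarrow> nat" where
  "diagonal n = fst (prod_decode n) + snd (prod_decode n)"

text \<open>Successive numbers walk along an antidiagonal; where it ends, at second component 0, the
  next one begins.\<close>

lemma prod_decode_Suc:
  "prod_decode (Suc n) =
    (case prod_decode n of (a, b) \<Rightarrow> if b = 0 then (0, Suc a) else (Suc a, b - 1))"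
proof (cases "prod_decode n")
  case (Pair a b)
  then have "n = prod_encode (a, b)"
    by (metis prod_decode_inverse)
  then have "Suc n = prod_encode (if b = 0 then (0, Suc a) else (Suc a, b - 1))"
    by (cases b) (auto simp: prod_encode_def)
  then show ?thesis
    using Pair by (simp only: prod_encode_inverse) simp
qed

lemma prod_decode_diagonal:
  "fst (prod_decode n) = n - triangle (diagonal n)"
  "snd (prod_decode n) = diagonal n - fst (prod_decode n)"
  "triangle (diagonal n) \<le> n"
proof -
  have "n = prod_encode (fst (prod_decode n), snd (prod_decode n))"
    by simp
  then have "n = triangle (diagonal n) + fst (prod_decode n)"
    by (simp only: prod_encode_def diagonal_def prod.case)
  then show "fst (prod_decode n) = n - triangle (diagonal n)" "triangle (diagonal n) \<le> n"
    by linarith+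
qed (simp add: diagonal_def)

text \<open>The next antidiagonal starts at \<open>triangle (Suc (diagonal n))\<close>. The test for
  having reached it involves only the counter and the previous value, as a primitive recursion
  requires.\<close>

lemma diagonal_Suc:
  "diagonal (Suc n) =
    (if triangle (Suc (diagonal n)) \<le> Suc n then Suc (diagonal n) else diagonal n)"
proof -
  have "n = triangle (diagonal n) + fst (prod_decode n)"
    using prod_decode_diagonal(1,3)[of n] by simp
  then have "triangle (Suc (diagonal n)) \<le> Suc n \<longleftrightarrow> snd (prod_decode n) = 0"
    using diagonal_def[of n] by auto
  then show ?thesis
    by (auto simp: diagonal_def prod_decode_Suc split: prod.splits)
qed

lemma recfun_diagonal: "recfun k f \<Longrightarrow> recfun k (\<lambda>xs. diagonal (f xs))"
  by (rule recfun_prim0[where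
        b = "\<lambda>i r. if triangle (Suc r) \<le> Suc i then Suc r else r"])
    (auto simp del: triangle_Suc simp: diagonal_Suc
      intro!: recfun_if_le recfun_triangle recfun_basic)

lemma recfun_fst_prod_decode: "recfun k f \<Longrightarrow> recfun k (\<lambda>xs. fst (prod_decode (f xs)))"
  unfolding prod_decode_diagonal(1) by (intro recfun_diff recfun_triangle recfun_diagonal)

lemma recfun_snd_prod_decode: "recfun k f \<Longrightarrow> recfun k (\<lambda>xs. snd (prod_decode (f xs)))"
  unfolding prod_decode_diagonal(2)
  by (intro recfun_diff recfun_diagonal recfun_fst_prod_decode)

section \<open>Head, tail and fold on list codes\<close>

definition hd_code :: "nat \<Rightarrow> nat" where
  "hd_code c = fst (prod_decode (c - 1))"

definition tl_code :: "nat \<Rightarrow> nat" where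
  "tl_code c = snd (prod_decode (c - 1))"

lemma hd_code: "hd_code (list_encode (x # xs)) = x"
  by (simp add: hd_code_def)

lemma tl_code: "tl_code (list_encode xs) = list_encode (tl xs)"
proof (cases xs)
  case Nil
  \<comment> \<open>The empty list has code 0, and \<open>0 - 1 = 0\<close>; decoding 0 makes its
    tail code 0 again, in accordance with \<open>tl [] = []\<close>.\<close>
  have "prod_decode 0 = (0, 0)"
    using prod_encode_inverse[of "(0, 0)"] by (simp add: prod_encode_def)
  then show ?thesis
    by (simp add: tl_code_def Nil)
qed (simp add: tl_code_def)

lemma funpow_tl_code: "(tl_code ^^ i) (list_encode xs) = list_encode (drop i xs)"
  by (induction i) (auto simp: tl_code drop_Suc tl_drop)

lemma list_encode_eq_0_iff: "list_encode xs = 0 \<longleftrightarrow> xs = []"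
  by (cases xs) auto

text \<open>Allows a code to stand in for a length, both as the number of iterations of a fold and
  in the search bound.\<close>

lemma length_le_list_encode: "length xs \<le> list_encode xs"
proof (induction xs)
  case (Cons x xs)
  then show ?case
    using le_prod_encode_2[of "list_encode xs" x] by simp
qed simp

lemma recfun_hd_code: "recfun k f \<Longrightarrow> recfun k (\<lambda>xs. hd_code (f xs))"
  unfolding hd_code_def by (intro recfun_fst_prod_decode recfun_pred)

lemma recfun_tl_code: "recfun k f \<Longrightarrow> recfun k (\<lambda>xs. tl_code (f xs))"
  unfolding tl_code_def by (intro recfun_snd_prod_decode recfun_pred)

lemma recfun_funpow_tl_code:
  "recfun k f \<Longrightarrow> recfun k g \<Longrightarrow> recfun k (\<lambda>xs. (tl_code ^^ f xs) (g xs))"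
  by (rule recfun_prim1[where F = "\<lambda>i. tl_code ^^ i" and a = "\<lambda>x. x" and b = "\<lambda>i r x. tl_code r"])
    (auto intro!: recfun_basic recfun_tl_code)

text \<open>The recursion is on the number of entries already processed. The next entry is the head
  of the corresponding tail of the unchanged code, so a single accumulator suffices as recursion
  value.\<close>

lemma recfun_fold:
  assumes S: "recfun 2 (\<lambda>xs. S (xs ! 0) (xs ! 1))" and "recfun k f" "recfun k g"
  shows "recfun k (\<lambda>xs. fold S (list_decode (f xs)) (g xs))"
proof -
  let ?F = "\<lambda>xs. fold S (take (xs ! 0) (list_decode (xs ! 1))) (xs ! 2)"
  \<comment> \<open>In the step, positions 0 to 3 hold the counter, the previous accumulator, the
    code and the initial accumulator. \<open>?r\<close> is the code of the unread entries; if it is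
    0, the accumulator stays as it is.\<close>
  let ?r = "\<lambda>xs. (tl_code ^^ (xs ! 0)) (xs ! 2)"
  let ?b = "\<lambda>xs. if ?r xs = 0 then xs ! 1 else S (hd_code (?r xs)) (xs ! 1)"
  have r: "recfun (Suc (Suc 2)) ?r"
    by (intro recfun_funpow_tl_code recfun_nth) auto
  have "recfun (Suc (Suc 2)) (\<lambda>xs. S (hd_code (?r xs)) (xs ! 1))"
    using recfun_comp2[OF S recfun_hd_code[OF r], of "\<lambda>xs. xs ! 1"] by (simp add: recfun_nth)
  then have b: "recfun (Suc (Suc 2)) ?b"
    by (intro recfun_if_zero r recfun_nth) auto
  have "recfun (Suc 2) ?F"
  proof (rule recfun_prim[OF recfun_nth[of 1 2] b])
    fix i :: nat and xs :: "nat list"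
    define ns where "ns = list_decode (xs ! 0)"
    then have w: "xs ! 0 = list_encode ns" by simp
    show "?F (Suc i # xs) = ?b (i # ?F (i # xs) # xs)"
    proof (cases "i < length ns")
      case True
      then have "(tl_code ^^ i) (xs ! 0) = list_encode (ns ! i # drop (Suc i) ns)"
        by (simp only: w funpow_tl_code Cons_nth_drop_Suc)
      then show ?thesis
        using True by (simp add: take_Suc_conv_app_nth ns_def[symmetric] hd_code del: list_encode.simps)
          (simp add: list_encode_eq_0_iff)
    next
      case False
      then have "(tl_code ^^ i) (xs ! 0) = 0"
        by (simp add: w funpow_tl_code)
      then show ?thesis
        using False by (simp add: ns_def[symmetric])
    qed
  qed auto
  then have "recfun 3 ?F" by simp
  \<comment> \<open>The code serves both as the list and as the number of steps; as it is at least
    the length, \<open>take\<close> returns the whole list.\<close>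
  from recfun_comp3[OF this assms(2,2,3)] show ?thesis
    using length_le_list_encode[of "list_decode _"] by (simp cong: if_cong)
qed

text \<open>The code of the list of \<open>i\<close> entries all equal to \<open>k\<close>, which by
  monotonicity of the pairing is the largest code of a list of at most \<open>i\<close> entries up
  to \<open>k\<close>.\<close>

fun list_code_bound :: "nat \<Rightarrow> nat \<Rightarrow> nat" where
  "list_code_bound k 0 = 0"
| "list_code_bound k (Suc i) = Suc (prod_encode (k, list_code_bound k i))"

lemma prod_encode_mono: "a \<le> c \<Longrightarrow> b \<le> d \<Longrightarrow> prod_encode (a, b) \<le> prod_encode (c, d)"
  unfolding prod_encode_def triangle_def
  by (auto intro!: add_mono div_le_mono mult_le_mono)

lemma list_encode_le_bound:
  "length xs \<le> i \<Longrightarrow> (\<And>x. x \<in> set xs \<Longrightarrow> x \<le> k) \<Longrightarrow> list_encode xs \<le> list_code_bound k i"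
proof (induction i arbitrary: xs)
  case (Suc i)
  then show ?case
    by (cases xs) (auto intro!: prod_encode_mono)
qed simp

lemma recfun_list_code_bound: "recfun k f \<Longrightarrow> recfun k (\<lambda>xs. list_code_bound c (f xs))"
  by (rule recfun_prim0[where b = "\<lambda>i r. Suc (prod_encode (c, r))"])
    (auto intro!: recfun_basic recfun_prod_encode)

section \<open>Words\<close>

lemma letter_code_inject: "letter_code x = letter_code y \<longleftrightarrow> x = y"
  by (cases x; cases y) (auto simp: letter_code_def of_bool_def split: if_splits)

definition cons_code :: "letter \<Rightarrow> nat \<Rightarrow> nat" where
  "cons_code x c =
    (if c = 0 then word_code [x]
     else if hd_code c = letter_code (flip x) then tl_code c
     else Suc (prod_encode (letter_code x, c)))"

lemma cons_code: "cons_code x (word_code w) = word_code (cons_red x w)"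
proof (cases w)
  case (Cons y ys)
  have "hd_code (word_code w) = letter_code y" "tl_code (word_code w) = word_code ys"
    "word_code w \<noteq> 0"
    using hd_code tl_code[of "map letter_code w"] by (simp_all add: word_code_def Cons del: list_encode.simps)
      (simp add: list_encode_eq_0_iff)
  then show ?thesis
    unfolding cons_code_def using Cons
    by (auto simp: letter_code_inject cons_red_def) (simp add: word_code_def)
qed (simp add: cons_code_def cons_red_def word_code_def)

lemma foldr_cons_code:
  "foldr cons_code w (word_code a) = word_code (foldr cons_red w a)"
  by (induction w) (auto simp: cons_code)

lemma recfun_cons_code: "recfun k f \<Longrightarrow> recfun k (\<lambda>xs. cons_code x (f xs))"
  unfolding cons_code_def
  by (intro recfun_if_zero recfun_if_eq recfun_const recfun_hd_code recfun_tl_code recfun_Suc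
      recfun_prod_encode)

lemma recfun_foldr_cons_code: "recfun k f \<Longrightarrow> recfun k (\<lambda>xs. foldr cons_code w (f xs))"
  by (induction w) (auto intro: recfun_cons_code)

section \<open>Left division on codes\<close>

definition letters :: "nat \<Rightarrow> letter list" where
  "letters n = List.product [0..<n] [True, False]"

lemma set_letters: "set (letters n) = {x. fst x < n}"
  by (auto simp: letters_def)

text \<open>The letters in \<open>xs\<close> and their images are constants of the program:
  \<open>c\<close> is compared with each of the finitely many codes in turn. A homomorphism thus
  enters only through a finite table, and unknown codes leave the accumulator unchanged.\<close>

definition letter_step :: "(letter \<Rightarrow> word) \<Rightarrow> letter list \<Rightarrow> nat \<Rightarrow> nat \<Rightarrow> nat" where
  "letter_step h xs c a =
    foldr (\<lambda>x r. if c = letter_code x then foldr cons_code (h x) a else r) xs a"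

lemma letter_step_letter:
  "x \<in> set xs \<Longrightarrow> letter_step h xs (letter_code x) a = foldr cons_code (h x) a"
  unfolding letter_step_def by (induction xs) (auto simp: letter_code_inject)

lemma letter_step_other: "c \<notin> letter_code ` set xs \<Longrightarrow> letter_step h xs c a = a"
  unfolding letter_step_def by (induction xs) auto

lemma recfun_letter_step: "recfun 2 (\<lambda>ys. letter_step h xs (ys ! 0) (ys ! 1))"
  unfolding letter_step_def
proof (induction xs)
  case (Cons x xs)
  show ?case
    unfolding foldr.simps comp_def
    by (intro recfun_if_eq recfun_const recfun_nth recfun_foldr_cons_code Cons.IH[unfolded comp_def]) simp_all
qed (simp add: recfun_nth)

lemma fold_letter_step_filter:
  "fold (letter_step h xs) ns a = fold (letter_step h xs) (filter (\<lambda>c. c \<in> letter_code ` set xs) ns) a"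
  by (induction ns arbitrary: a) (auto simp: letter_step_other)

text \<open>Later letters are multiplied further to the left, which explains \<open>rev\<close>.
  With inverted images in place of \<open>h\<close>, the reversed product is the inverse of the
  image of \<open>w\<close>.\<close>

lemma fold_letter_step:
  "set w \<subseteq> set xs \<Longrightarrow> fold (letter_step h xs) (map letter_code w) (word_code a) =
    word_code (foldr cons_red (concat (map h (rev w))) a)"
  by (induction w arbitrary: a) (auto simp: letter_step_letter foldr_cons_code)

definition left_div :: "nat \<Rightarrow> (word \<Rightarrow> word) \<Rightarrow> nat \<Rightarrow> nat \<Rightarrow> nat" where
  "left_div n \<phi> c a = fold (letter_step (\<lambda>x. word_inv (\<phi> [x])) (letters n)) (list_decode c) a"

lemma recfun_left_div:
  "recfun k f \<Longrightarrow> recfun k g \<Longrightarrow> recfun k (\<lambda>xs. left_div n \<phi> (f xs) (g xs))"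
  unfolding left_div_def by (intro recfun_fold recfun_letter_step)

text \<open>Numbers that are not codes of words act like words, since letters outside the alphabet are
  skipped; hence a search over all numbers below a bound finds only genuine solutions.\<close>

lemma left_div_eq_word_code:
  obtains w where "w \<in> words n" "\<And>\<phi> a. left_div n \<phi> c a = left_div n \<phi> (word_code w) a"
proof -
  let ?ns = "filter (\<lambda>d. d \<in> letter_code ` set (letters n)) (list_decode c)"
  have "\<forall>d\<in>set ?ns. \<exists>x. x \<in> set (letters n) \<and> d = letter_code x"
    by auto
  then obtain f where f: "\<And>d. d \<in> set ?ns \<Longrightarrow> f d \<in> set (letters n) \<and> letter_code (f d) = d"
    by metis
  have "map letter_code (map f ?ns) = ?ns"
    unfolding map_map by (rule map_idI) (use f in auto)
  then have "left_div n \<phi> c a = left_div n \<phi> (word_code (map f ?ns)) a" for \<phi> a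
    unfolding left_div_def word_code_def list_encode_inverse
    by (metis fold_letter_step_filter)
  moreover have "map f ?ns \<in> words n"
    using f by (auto simp: words_def set_letters)
  ultimately show ?thesis
    by (rule that[rotated])
qed

lemma left_div:
  assumes hom: "\<phi> \<in> hom (free_group n) (free_group m)"
    and w: "w \<in> words n" and a: "a \<in> carrier (free_group m)"
  shows "left_div n \<phi> (word_code w) (word_code a) =
    word_code (inv\<^bsub>free_group m\<^esub> (\<phi> (reduce w)) \<otimes>\<^bsub>free_group m\<^esub> a)"
proof -
  interpret group_hom "free_group n" "free_group m" \<phi>
    using hom by (rule hom_free_group)
  let ?v = "concat (map (\<lambda>x. \<phi> [x]) w)"
  have w': "fst x < n" if "x \<in> set w" for x
    using w that by (auto simp: words_def)
  have "?v \<in> words m"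
    using hom_closed[OF letter_in_free_group] w' by (fastforce simp: carrier_free_group words_def)
  then have "reduce ?v \<in> carrier (free_group m)" "reduce (word_inv ?v) \<in> carrier (free_group m)"
    by (auto intro: reduce_in_free_group words_word_inv)
  moreover have "reduce (word_inv ?v) \<otimes>\<^bsub>free_group m\<^esub> reduce ?v = \<one>\<^bsub>free_group m\<^esub>"
    by (simp add: mult_free_group one_free_group reduce_append_left reduce_append_right
        reduce_word_inv_append)
  ultimately have "inv\<^bsub>free_group m\<^esub> (\<phi> (reduce w)) = reduce (word_inv ?v)"
    by (simp add: hom_reduce[OF hom w] H.inv_equality)
  \<comment> \<open>The fold multiplies by the unreduced word \<open>word_inv ?v\<close>; by
    \<open>foldr_reduce\<close> this agrees with multiplication by its reduction.\<close>
  then have "inv\<^bsub>free_group m\<^esub> (\<phi> (reduce w)) \<otimes>\<^bsub>free_group m\<^esub> a = foldr cons_red (word_inv ?v) a"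
    using a by (simp add: mult_free_group reduce_append foldr_reduce reduce_reduced
        carrier_free_group)
  moreover have "set w \<subseteq> set (letters n)"
    using w' by (auto simp: set_letters)
  ultimately show ?thesis
    by (simp add: left_div_def word_code_def[of w] fold_letter_step word_inv_concat rev_map comp_def)
qed

lemma word_code_eq_0_iff: "word_code w = 0 \<longleftrightarrow> w = []"
  by (simp add: word_code_def list_encode_eq_0_iff)

lemma length_le_word_code: "length w \<le> word_code w"
  using length_le_list_encode[of "map letter_code w"] by (simp add: word_code_def)

section \<open>Decidability\<close>

text \<open>Built from left divisions alone, with 0 as the code of the identity: dividing the
  identity by an element inverts it, and dividing by an inverse multiplies. This double inversion
  yields \<open>u\<close> times the image of \<open>z\<close> under \<open>\<psi>\<close>.\<close>

definition twisted_quotient ::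
  "nat \<Rightarrow> nat \<Rightarrow> (word \<Rightarrow> word) \<Rightarrow> (word \<Rightarrow> word) \<Rightarrow> nat \<Rightarrow> nat \<Rightarrow> nat \<Rightarrow> nat" where
  "twisted_quotient n m \<phi> \<psi> z u v =
    left_div m id v (left_div n \<phi> z (left_div m id (left_div m id u 0)
      (left_div m id (left_div n \<psi> z 0) 0)))"

lemma recfun_twisted_quotient:
  "recfun k f \<Longrightarrow> recfun k g \<Longrightarrow> recfun k h \<Longrightarrow>
    recfun k (\<lambda>xs. twisted_quotient n m \<phi> \<psi> (f xs) (g xs) (h xs))"
  unfolding twisted_quotient_def by (intro recfun_left_div recfun_const)

lemma twisted_quotient:
  assumes \<phi>: "\<phi> \<in> hom (free_group n) (free_group m)" and \<psi>: "\<psi> \<in> hom (free_group n) (free_group m)"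
    and z: "z \<in> words n" and u: "u \<in> words m" and v: "v \<in> words m"
  shows "twisted_quotient n m \<phi> \<psi> (word_code z) (word_code u) (word_code v) = 0 \<longleftrightarrow>
    reduce u = \<phi> (reduce z) \<otimes>\<^bsub>free_group m\<^esub> reduce v \<otimes>\<^bsub>free_group m\<^esub> inv\<^bsub>free_group m\<^esub> (\<psi> (reduce z))"
proof -
  interpret \<phi>: group_hom "free_group n" "free_group m" \<phi>
    using \<phi> by (rule hom_free_group)
  interpret \<psi>: group_hom "free_group n" "free_group m" \<psi>
    using \<psi> by (rule hom_free_group)
  let ?H = "free_group m"
  have id: "id \<in> hom ?H ?H"
    by (simp add: hom_def)
  have red: "x \<in> words m \<and> reduce x = x" if "x \<in> carrier ?H" for x
    using that by (simp add: carrier_free_group reduce_reduced)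
  have code0: "0 = word_code \<one>\<^bsub>?H\<^esub>"
    by (simp add: one_free_group word_code_def)
  have cl: "reduce u \<in> carrier ?H" "reduce v \<in> carrier ?H"
    "\<phi> (reduce z) \<in> carrier ?H" "\<psi> (reduce z) \<in> carrier ?H"
    using u v z by (simp_all add: reduce_in_free_group)
  \<comment> \<open>\<open>div\<close> serves for divisors that are reduced intermediate results,
    \<open>div'\<close> for the input words, which may be unreduced.\<close>
  have div: "left_div m id (word_code x) (word_code a) = word_code (inv\<^bsub>?H\<^esub> x \<otimes>\<^bsub>?H\<^esub> a)"
    if "x \<in> carrier ?H" "a \<in> carrier ?H" for x a
    using left_div[OF id _ that(2), of x] red[OF that(1)] by simp
  have div': "left_div m id (word_code x) (word_code a) = word_code (inv\<^bsub>?H\<^esub> reduce x \<otimes>\<^bsub>?H\<^esub> a)"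
    if "x \<in> words m" "a \<in> carrier ?H" for x a
    using left_div[OF id that] by simp
  have "twisted_quotient n m \<phi> \<psi> (word_code z) (word_code u) (word_code v) =
    word_code (inv\<^bsub>?H\<^esub> reduce v \<otimes>\<^bsub>?H\<^esub> (inv\<^bsub>?H\<^esub> \<phi> (reduce z) \<otimes>\<^bsub>?H\<^esub> (reduce u \<otimes>\<^bsub>?H\<^esub> \<psi> (reduce z))))"
    unfolding twisted_quotient_def code0
    using cl by (simp add: left_div[OF \<phi> z] left_div[OF \<psi> z] div' u v div)
  also have "\<dots> = 0 \<longleftrightarrow>
    inv\<^bsub>?H\<^esub> reduce v \<otimes>\<^bsub>?H\<^esub> (inv\<^bsub>?H\<^esub> \<phi> (reduce z) \<otimes>\<^bsub>?H\<^esub> (reduce u \<otimes>\<^bsub>?H\<^esub> \<psi> (reduce z))) = \<one>\<^bsub>?H\<^esub>"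
    by (simp add: word_code_eq_0_iff one_free_group)
  also have "\<dots> \<longleftrightarrow> reduce v = inv\<^bsub>?H\<^esub> \<phi> (reduce z) \<otimes>\<^bsub>?H\<^esub> (reduce u \<otimes>\<^bsub>?H\<^esub> \<psi> (reduce z))"
    using cl by (metis \<phi>.H.inv_closed \<phi>.H.inv_solve_left \<phi>.H.m_closed \<phi>.H.one_closed \<phi>.H.r_one)
  also have "\<dots> \<longleftrightarrow> reduce u \<otimes>\<^bsub>?H\<^esub> \<psi> (reduce z) = \<phi> (reduce z) \<otimes>\<^bsub>?H\<^esub> reduce v"
    using cl by (metis \<phi>.H.inv_solve_left \<phi>.H.m_closed)
  also have "\<dots> \<longleftrightarrow> reduce u = \<phi> (reduce z) \<otimes>\<^bsub>?H\<^esub> reduce v \<otimes>\<^bsub>?H\<^esub> inv\<^bsub>?H\<^esub> (\<psi> (reduce z))"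
    using cl by (metis \<phi>.H.inv_solve_right \<phi>.H.m_closed)
  finally show ?thesis .
qed

text \<open>A recursive function is provided instead of a decidability statement, so that its
  arguments can still be exchanged or fixed.\<close>

lemma recfun_twisted_conjugate:
  assumes \<phi>: "\<phi> \<in> hom (free_group n) (free_group m)" and \<psi>: "\<psi> \<in> hom (free_group n) (free_group m)"
    and rem: "has_remnant n m \<phi>" and less: "\<forall>i<n. length (Rem n m \<phi> i) > length (\<psi> (gen i))"
  obtains D where "recfun 2 D"
    "\<And>u v. u \<in> words m \<Longrightarrow> v \<in> words m \<Longrightarrow> D [word_code u, word_code v] =
      of_bool (\<exists>z\<in>carrier (free_group n).
        reduce u = \<phi> z \<otimes>\<^bsub>free_group m\<^esub> reduce v \<otimes>\<^bsub>free_group m\<^esub> inv\<^bsub>free_group m\<^esub> (\<psi> z))"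
proof
  let ?t = "\<lambda>xs. twisted_quotient n m \<phi> \<psi> (xs ! 0) (xs ! 1) (xs ! 2)"
  \<comment> \<open>The sum bounds every letter code, also for the empty alphabet. In
    \<open>?D\<close> the input codes replace the lengths they dominate; \<open>Suc\<close> includes
    the bound itself.\<close>
  define K where "K = sum_list (map letter_code (letters n))"
  let ?D = "\<lambda>xs. of_bool (\<exists>j<Suc (list_code_bound K (xs ! 0 + xs ! 1)). ?t (j # xs) = 0) :: nat"
  show "recfun 2 ?D"
    by (intro recfun_bounded_ex recfun_twisted_quotient recfun_Suc recfun_list_code_bound recfun_add
        recfun_nth) auto
  fix u v assume u: "u \<in> words m" and v: "v \<in> words m"
  let ?P = "\<lambda>z. reduce u = \<phi> z \<otimes>\<^bsub>free_group m\<^esub> reduce v \<otimes>\<^bsub>free_group m\<^esub> inv\<^bsub>free_group m\<^esub> (\<psi> z)"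
  let ?q = "\<lambda>j. twisted_quotient n m \<phi> \<psi> j (word_code u) (word_code v)"
  \<comment> \<open>Soundness: the number found acts like some word, and the reduction of that word
    is a solution.\<close>
  have "\<exists>z\<in>carrier (free_group n). ?P z" if "?q j = 0" for j
  proof -
    obtain w where w: "w \<in> words n" "\<And>\<phi> a. left_div n \<phi> j a = left_div n \<phi> (word_code w) a"
      by (rule left_div_eq_word_code[of n j]) blast
    have "?q (word_code w) = 0"
      using that by (simp add: twisted_quotient_def w(2))
    then show ?thesis
      using twisted_quotient[OF \<phi> \<psi> w(1) u v] reduce_in_free_group[OF w(1)] by blast
  qed
  \<comment> \<open>Completeness: the length bound places the code of every solution inside the
    search range.\<close>
  moreover have "\<exists>j<Suc (list_code_bound K (word_code u + word_code v)). ?q j = 0"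
    if z: "z \<in> carrier (free_group n)" "?P z" for z
  proof (intro exI conjI)
    have z': "z \<in> words n" "reduce z = z"
      using z(1) by (auto simp: carrier_free_group reduce_reduced)
    show "?q (word_code z) = 0"
      using twisted_quotient[OF \<phi> \<psi> z'(1) u v] z z' by simp
    have "length z \<le> length (reduce u) + length (reduce v)"
      using twisted_conjugator_length[OF \<phi> \<psi> rem less z(1) reduce_in_free_group reduce_in_free_group z(2)]
        u v by blast
    also have "\<dots> \<le> word_code u + word_code v"
      using length_reduce_le length_le_word_code by (meson add_mono le_trans)
    finally have "length (map letter_code z) \<le> word_code u + word_code v"
      by simp
    moreover have "d \<le> K" if "d \<in> set (map letter_code z)" for d
    proof -
      have "d \<in> set (map letter_code (letters n))"
        using that z'(1) by (auto simp: set_letters words_def)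
      then show ?thesis
        unfolding K_def by (intro member_le_sum_list) auto
    qed
    ultimately show "word_code z < Suc (list_code_bound K (word_code u + word_code v))"
      unfolding word_code_def[of z] less_Suc_eq_le by (rule list_encode_le_bound)
  qed
  ultimately have "(\<exists>j<Suc (list_code_bound K (word_code u + word_code v)). ?q j = 0) \<longleftrightarrow>
      (\<exists>z\<in>carrier (free_group n). ?P z)"
    by blast
  then show "?D [word_code u, word_code v] = of_bool (\<exists>z\<in>carrier (free_group n). ?P z)"
    by (simp add: numeral_2_eq_2)
qed

lemma decidable1I:
  assumes "recfun 1 D" "\<And>u. u \<in> words n \<Longrightarrow> D [word_code u] = of_bool (P (reduce u))"
  shows "decidable1 n P"
  using assms unfolding decidable1_def recfun_def by (metis One_nat_def length_Cons list.size(3))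

lemma decidable2I:
  assumes "recfun 2 D" "\<And>u v. u \<in> words n \<Longrightarrow> v \<in> words n \<Longrightarrow>
    D [word_code u, word_code v] = of_bool (P (reduce u) (reduce v))"
  shows "decidable2 n P"
  using assms unfolding decidable2_def recfun_def
  by (metis One_nat_def Suc_1 length_Cons list.size(3))

theorem corollary13:
  fixes n m :: nat
  shows
    "(\<forall>\<phi> \<psi>. \<phi> \<in> hom (free_group n) (free_group m) \<longrightarrow> \<psi> \<in> hom (free_group n) (free_group m) \<longrightarrow> has_remnant n m \<phi> \<longrightarrow>
        (\<forall>i<n. length (Rem n m \<phi> i) > length (\<psi> (gen i))) \<longrightarrow>
        decidable2 m (\<lambda>u v. \<exists>z\<in>carrier (free_group n). u = \<phi> z \<otimes>\<^bsub>free_group m\<^esub> v \<otimes>\<^bsub>free_group m\<^esub> inv\<^bsub>free_group m\<^esub> (\<psi> z)))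
   \<and> (\<forall>\<phi>. \<phi> \<in> hom (free_group n) (free_group n) \<longrightarrow> has_remnant n n \<phi> \<longrightarrow>
        (\<forall>i<n. length (Rem n n \<phi> i) > 1) \<longrightarrow>
        decidable2 n (\<lambda>u v. \<exists>z\<in>carrier (free_group n). v = \<phi> z \<otimes>\<^bsub>free_group n\<^esub> u \<otimes>\<^bsub>free_group n\<^esub> inv\<^bsub>free_group n\<^esub> z))
   \<and> (\<forall>\<phi>. \<phi> \<in> hom (free_group n) (free_group m) \<longrightarrow> has_remnant n m \<phi> \<longrightarrow>
        decidable1 m (\<lambda>w. w \<in> \<phi> ` carrier (free_group n)))"
proof (intro conjI allI impI)
  fix \<phi> \<psi>
  assume "\<phi> \<in> hom (free_group n) (free_group m)" "\<psi> \<in> hom (free_group n) (free_group m)"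
    "has_remnant n m \<phi>" "\<forall>i<n. length (Rem n m \<phi> i) > length (\<psi> (gen i))"
  then obtain D where "recfun 2 D"
    "\<And>u v. u \<in> words m \<Longrightarrow> v \<in> words m \<Longrightarrow> D [word_code u, word_code v] =
      of_bool (\<exists>z\<in>carrier (free_group n).
        reduce u = \<phi> z \<otimes>\<^bsub>free_group m\<^esub> reduce v \<otimes>\<^bsub>free_group m\<^esub> inv\<^bsub>free_group m\<^esub> (\<psi> z))"
    using recfun_twisted_conjugate by blast
  then show "decidable2 m (\<lambda>u v. \<exists>z\<in>carrier (free_group n).
      u = \<phi> z \<otimes>\<^bsub>free_group m\<^esub> v \<otimes>\<^bsub>free_group m\<^esub> inv\<^bsub>free_group m\<^esub> (\<psi> z))"
    by (rule decidable2I)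
next
  fix \<phi>
  assume \<phi>: "\<phi> \<in> hom (free_group n) (free_group n)" "has_remnant n n \<phi>"
    "\<forall>i<n. length (Rem n n \<phi> i) > 1"
  have "id \<in> hom (free_group n) (free_group n)"
    by (simp add: hom_def)
  moreover have "\<forall>i<n. length (Rem n n \<phi> i) > length (id (gen i))"
    using \<phi>(3) by (simp add: gen_def)
  ultimately obtain D where D: "recfun 2 D"
    "\<And>u v. u \<in> words n \<Longrightarrow> v \<in> words n \<Longrightarrow> D [word_code u, word_code v] =
      of_bool (\<exists>z\<in>carrier (free_group n).
        reduce u = \<phi> z \<otimes>\<^bsub>free_group n\<^esub> reduce v \<otimes>\<^bsub>free_group n\<^esub> inv\<^bsub>free_group n\<^esub> (id z))"
    using recfun_twisted_conjugate[OF \<phi>(1) _ \<phi>(2)] by blast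
  \<comment> \<open>The singly-twisted equation is solved for \<open>v\<close>, so the inputs are
    exchanged.\<close>
  have "recfun 2 (\<lambda>xs. D [xs ! 1, xs ! 0])"
    by (rule recfun_comp2[OF D(1) recfun_nth recfun_nth]) simp_all
  then show "decidable2 n (\<lambda>u v. \<exists>z\<in>carrier (free_group n).
      v = \<phi> z \<otimes>\<^bsub>free_group n\<^esub> u \<otimes>\<^bsub>free_group n\<^esub> inv\<^bsub>free_group n\<^esub> z)"
    by (rule decidable2I) (simp add: D(2))
next
  fix \<phi>
  assume \<phi>: "\<phi> \<in> hom (free_group n) (free_group m)" "has_remnant n m \<phi>"
  interpret group_hom "free_group n" "free_group m" \<phi>
    using \<phi>(1) by (rule hom_free_group)
  have "(\<lambda>_. []) \<in> hom (free_group n) (free_group m)"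
    using H.one_closed H.r_one[OF H.one_closed] by (simp add: hom_def one_free_group)
  \<comment> \<open>For the trivial homomorphism the length condition says that the remnants are
    nonempty, which is what having remnant means.\<close>
  moreover have "\<forall>i<n. length (Rem n m \<phi> i) > length []"
    using \<phi>(2) by (auto simp: length_Rem has_remnant_def tuple_has_remnant_def)
  ultimately obtain D where D: "recfun 2 D"
    "\<And>u v. u \<in> words m \<Longrightarrow> v \<in> words m \<Longrightarrow> D [word_code u, word_code v] =
      of_bool (\<exists>z\<in>carrier (free_group n).
        reduce u = \<phi> z \<otimes>\<^bsub>free_group m\<^esub> reduce v \<otimes>\<^bsub>free_group m\<^esub> inv\<^bsub>free_group m\<^esub> [])"
    using recfun_twisted_conjugate[OF \<phi>(1) _ \<phi>(2)] by blast
  have D1: "D [word_code u, word_code []] = of_bool (reduce u \<in> \<phi> ` carrier (free_group n))"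
    if "u \<in> words m" for u
  proof -
    have one: "reduce [] = \<one>\<^bsub>free_group m\<^esub>" "[] = \<one>\<^bsub>free_group m\<^esub>"
      by (simp_all add: one_free_group reduce_def)
    have eq: "\<phi> z \<otimes>\<^bsub>free_group m\<^esub> reduce [] \<otimes>\<^bsub>free_group m\<^esub> inv\<^bsub>free_group m\<^esub> [] = \<phi> z"
      if "z \<in> carrier (free_group n)" for z
      \<comment> \<open>Two separate rewritings: \<open>one(2)\<close> would otherwise change the
        argument inside \<open>reduce []\<close> before \<open>one(1)\<close> applies.\<close>
      unfolding one(1) unfolding one(2) using that by simp
    have "D [word_code u, word_code []] = of_bool (\<exists>z\<in>carrier (free_group n). reduce u = \<phi> z)"
      unfolding D(2)[OF that words_Nil] by (simp only: eq cong: bex_cong)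
    then show ?thesis
      by (simp only: image_iff)
  qed
  have "recfun 1 (\<lambda>xs. D [xs ! 0, word_code []])"
    by (rule recfun_comp2[OF D(1) recfun_nth recfun_const]) simp
  then show "decidable1 m (\<lambda>w. w \<in> \<phi> ` carrier (free_group n))"
    by (rule decidable1I) (simp add: D1)
qed

end
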